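(* Let $n\ge 2$, let $\mathcal{D}$ be a finite family of nonzero vectors in $\mathbb{R}^n$ and let $k\in\mathbb{N}$ satisfy $1\le k\le|\mathcal{D}|$. Then $\mathcal{D}$ is a positive $k$-spanning set of $\mathbb{R}^n$ if and only if $\mathrm{cm}_k(\mathcal{D})>0$.
   Context: Families of vectors may contain repetitions, and cardinalities and subfamilies are counted with multiplicity. For a finite family $\mathcal{D}$, $\mathrm{pspan}(\mathcal{D})$ is the set of all linear combinations of elements of $\mathcal{D}$ with nonnegative coefficients. For $k\ge1$, the positive $k$-span of a finite family $\mathcal{D}$ in $\mathbb{R}^n$ is $$\mathrm{pspan}_k(\mathcal{D})=\bigcap_{\mathcal{S}\subset\mathcal{D},\ |\mathcal{S}|\ge|\mathcal{D}|-k+1}\mathrm{pspan}(\mathcal{S}),$$ and $\mathcal{D}$ is a positive $k$-spanning set of $\mathbb{R}^n$ if $\mathrm{pspan}_k(\mathcal{D})=\mathbb{R}^n$. For a finite family $\mathcal{D}$ of nonzero vectors in $\mathbb{R}^n$ and $1\le k\le|\mathcal{D}|$, the $k$-cosine measure is $$\mathrm{cm}_k(\mathcal{D})=\min_{\mathbf{u}\in\mathbb{R}^n,\ \|\mathbf{u}\|=1}\ \max_{\mathcal{S}\subset\mathcal{D},\ |\mathcal{S}|=k}\ \min_{\mathbf{d}\in\mathcal{S}}\frac{\mathbf{u}^\top\mathbf{d}}{\|\mathbf{d}\|}.$$ *)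

theory Defs
  imports "HOL-Analysis.Analysis"
begin

text \<open>
  A finite family of vectors, possibly with repetitions, is a function \<open>D\<close> together with a finite
  index set \<open>I\<close>. Its subfamilies are the restrictions of \<open>D\<close> to subsets of \<open>I\<close>, so that
  cardinalities count multiplicity.
\<close>

definition pspan :: "'i set \<Rightarrow> ('i \<Rightarrow> 'a::real_vector) \<Rightarrow> 'a set" where
  "pspan I D = {\<Sum>i\<in>I. c i *\<^sub>R D i | c. \<forall>i\<in>I. 0 \<le> c i}"

text \<open>
  The condition \<open>|J| \<ge> |I| - k + 1\<close> is written additively to avoid truncated subtraction.
\<close>

definition pspan_k :: "nat \<Rightarrow> 'i set \<Rightarrow> ('i \<Rightarrow> 'a::real_vector) \<Rightarrow> 'a set" where
  "pspan_k k I D = (\<Inter>J\<in>{J. J \<subseteq> I \<and> card J + k \<ge> card I + 1}. pspan J D)"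

definition positive_k_spanning_set :: "nat \<Rightarrow> 'i set \<Rightarrow> ('i \<Rightarrow> 'a::real_vector) \<Rightarrow> bool" where
  "positive_k_spanning_set k I D \<longleftrightarrow> pspan_k k I D = UNIV"

definition max_min_cosine :: "nat \<Rightarrow> 'i set \<Rightarrow> ('i \<Rightarrow> 'a::real_inner) \<Rightarrow> 'a \<Rightarrow> real" where
  "max_min_cosine k I D u =
     (MAX J\<in>{J. J \<subseteq> I \<and> card J = k}. MIN i\<in>J. (u \<bullet> D i) / norm (D i))"

text \<open>
  The outer minimum, over the infinite unit sphere, is written as an infimum; it is attained
  by lemma \<open>cosine_measure_k_attained\<close> below.
\<close>

definition cosine_measure_k :: "nat \<Rightarrow> 'i set \<Rightarrow> ('i \<Rightarrow> 'a::real_inner) \<Rightarrow> real" where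
  "cosine_measure_k k I D = (INF u\<in>{u. norm u = 1}. max_min_cosine k I D u)"

lemma continuous_on_Max_image:
  fixes f :: "'b \<Rightarrow> 'a::topological_space \<Rightarrow> real"
  assumes "finite A" "A \<noteq> {}" "\<And>a. a \<in> A \<Longrightarrow> continuous_on S (f a)"
  shows "continuous_on S (\<lambda>x. MAX a\<in>A. f a x)"
  using assms
proof (induction A rule: finite_ne_induct)
  case (insert a A)
  then have "(\<lambda>x. MAX b\<in>insert a A. f b x) = (\<lambda>x. max (f a x) (MAX b\<in>A. f b x))"
    by simp
  then show ?case using insert by (simp add: continuous_on_max)
qed simp

lemma continuous_on_Min_image:
  fixes f :: "'b \<Rightarrow> 'a::topological_space \<Rightarrow> real"
  assumes "finite A" "A \<noteq> {}" "\<And>a. a \<in> A \<Longrightarrow> continuous_on S (f a)"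
  shows "continuous_on S (\<lambda>x. MIN a\<in>A. f a x)"
  using assms
proof (induction A rule: finite_ne_induct)
  case (insert a A)
  then have "(\<lambda>x. MIN b\<in>insert a A. f b x) = (\<lambda>x. min (f a x) (MIN b\<in>A. f b x))"
    by simp
  then show ?case using insert by (simp add: continuous_on_min)
qed simp

lemma continuous_on_max_min_cosine:
  fixes D :: "'i \<Rightarrow> 'a::real_inner"
  assumes "finite I" "1 \<le> k" "k \<le> card I"
  shows "continuous_on S (max_min_cosine k I D)"
proof -
  have "finite {J. J \<subseteq> I \<and> card J = k}" using assms by auto
  moreover have "{J. J \<subseteq> I \<and> card J = k} \<noteq> {}"
    using assms by (metis (mono_tags, lifting) empty_Collect_eq obtain_subset_with_card_n)
  moreover have "continuous_on S (\<lambda>u. MIN i\<in>J. (u \<bullet> D i) / norm (D i))"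
    if "J \<in> {J. J \<subseteq> I \<and> card J = k}" for J
  proof (rule continuous_on_Min_image)
    show "finite J" using that assms finite_subset by auto
    show "J \<noteq> {}" using that assms by auto
    show "continuous_on S (\<lambda>u. (u \<bullet> D i) / norm (D i))" for i
      unfolding divide_inverse by (intro continuous_intros)
  qed
  ultimately show ?thesis
    unfolding max_min_cosine_def[abs_def] by (rule continuous_on_Max_image)
qed

lemma cosine_measure_k_attained:
  fixes D :: "'i \<Rightarrow> 'a::euclidean_space"
  assumes "finite I" "1 \<le> k" "k \<le> card I"
  obtains u where "norm u = 1" "cosine_measure_k k I D = max_min_cosine k I D u"
    "\<And>v. norm v = 1 \<Longrightarrow> cosine_measure_k k I D \<le> max_min_cosine k I D v"
proof -
  have S: "{u::'a. norm u = 1} = sphere 0 1" by auto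
  have ne: "sphere (0::'a) 1 \<noteq> {}" by simp
  obtain u :: 'a where u: "u \<in> sphere 0 1"
    "\<And>v. v \<in> sphere 0 1 \<Longrightarrow> max_min_cosine k I D u \<le> max_min_cosine k I D v"
    using continuous_attains_inf[OF compact_sphere ne continuous_on_max_min_cosine[OF assms]]
    by metis
  have "cosine_measure_k k I D = max_min_cosine k I D u"
    unfolding cosine_measure_k_def S by (rule cInf_eq_minimum) (use u in auto)
  then show thesis using that[of u] u by simp
qed

end

theory Submission
  imports Defs
begin

text \<open>
  Both properties say that every open half-space bounded by a hyperplane through the origin
  contains at least \<open>k\<close> members of the family, that is, that for every \<open>u \<noteq> 0\<close> the set
  \<open>P u = {i \<in> I. 0 < u \<bullet> D i}\<close> has at least \<open>k\<close> elements.

  For the positive \<open>k\<close>-span, the case \<open>k = 1\<close> is the classical characterisation of positive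
  spanning sets (\<open>pspan_eq_UNIV_iff\<close>), where the substantial direction comes from separating a
  point from the convex cone \<open>pspan J D\<close>. Applying it to every subfamily shows that
  \<open>D\<close> is positive \<open>k\<close>-spanning iff no \<open>P u\<close> is avoided by an index set \<open>J\<close> of size at least
  \<open>card I - k + 1\<close>. The largest \<open>J\<close> that avoids \<open>P u\<close> is its complement, so this means
  \<open>card (P u) \<ge> k\<close>.

  For the cosine measure, the norms in the denominators do not affect signs. The max-min
  at \<open>u\<close> is therefore positive iff some \<open>k\<close>-subset of \<open>I\<close> lies inside \<open>P u\<close>, which again means
  \<open>card (P u) \<ge> k\<close>. Because the minimum over the unit sphere is attained, pointwise
  positivity is the same as positivity of the measure.
\<close>

lemma convex_pspan: "convex (pspan J D)"
proof (rule convexI)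
  fix x y u v
  assume "x \<in> pspan J D" "y \<in> pspan J D" and uv: "0 \<le> (u::real)" "0 \<le> (v::real)"
  then obtain c d where c: "x = (\<Sum>i\<in>J. c i *\<^sub>R D i)" "\<forall>i\<in>J. 0 \<le> c i"
    and d: "y = (\<Sum>i\<in>J. d i *\<^sub>R D i)" "\<forall>i\<in>J. 0 \<le> d i"
    unfolding pspan_def by auto
  have "u *\<^sub>R x + v *\<^sub>R y = (\<Sum>i\<in>J. (u * c i + v * d i) *\<^sub>R D i)"
    by (simp add: c(1) d(1) scaleR_sum_right sum.distrib scaleR_add_left)
  then show "u *\<^sub>R x + v *\<^sub>R y \<in> pspan J D"
    unfolding pspan_def using c d uv by (auto intro!: exI[of _ "\<lambda>i. u * c i + v * d i"])
qed

lemma scaleR_mem_pspan: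
  assumes "finite J" "i \<in> J" "0 \<le> t"
  shows "t *\<^sub>R D i \<in> pspan J D"
proof -
  have "(\<Sum>j\<in>J. (if j = i then t else 0) *\<^sub>R D j) = (\<Sum>j\<in>J. if j = i then t *\<^sub>R D j else 0)"
    by (intro sum.cong) auto
  also have "\<dots> = t *\<^sub>R D i"
    using assms by (simp add: sum.delta')
  finally show ?thesis
    unfolding pspan_def using assms
    by (auto intro!: exI[of _ "\<lambda>j. if j = i then t else 0"])
qed

text \<open>
  If \<open>u\<close> itself is a nonnegative combination of the vectors, then \<open>u \<bullet> u > 0\<close> forces one of them
  to have a positive inner product with \<open>u\<close>. Conversely, a point outside the cone is weakly
  separated from it by some \<open>a \<noteq> 0\<close>, and a linear functional that is bounded above on a cone is
  nonpositive there.
\<close>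

lemma pspan_eq_UNIV_iff:
  fixes D :: "'i \<Rightarrow> 'a::euclidean_space"
  assumes "finite J"
  shows "pspan J D = UNIV \<longleftrightarrow> (\<forall>u. u \<noteq> 0 \<longrightarrow> (\<exists>i\<in>J. 0 < u \<bullet> D i))"
proof
  assume span: "pspan J D = UNIV"
  show "\<forall>u. u \<noteq> 0 \<longrightarrow> (\<exists>i\<in>J. 0 < u \<bullet> D i)"
  proof (intro allI impI, rule ccontr)
    fix u :: 'a
    assume u: "u \<noteq> 0" and "\<not> (\<exists>i\<in>J. 0 < u \<bullet> D i)"
    then have neg: "u \<bullet> D i \<le> 0" if "i \<in> J" for i
      using that by force
    have "u \<in> pspan J D" using span by simp
    then obtain c where c: "u = (\<Sum>i\<in>J. c i *\<^sub>R D i)" "\<forall>i\<in>J. 0 \<le> c i"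
      unfolding pspan_def by auto
    have "u \<bullet> u = u \<bullet> (\<Sum>i\<in>J. c i *\<^sub>R D i)"
      using c(1) by simp
    also have "\<dots> = (\<Sum>i\<in>J. c i * (u \<bullet> D i))"
      by (simp add: inner_sum_right)
    also have "\<dots> \<le> 0"
      using c(2) neg by (intro sum_nonpos mult_nonneg_nonpos) auto
    finally show False using u by (simp add: inner_gt_zero_iff flip: not_less)
  qed
next
  assume pos: "\<forall>u. u \<noteq> 0 \<longrightarrow> (\<exists>i\<in>J. 0 < u \<bullet> D i)"
  show "pspan J D = UNIV"
  proof (rule ccontr)
    assume "pspan J D \<noteq> UNIV"
    then obtain x where x: "x \<notin> pspan J D" by auto
    have "0 \<in> pspan J D"
      unfolding pspan_def by (auto intro!: exI[of _ "\<lambda>_. 0"])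
    then obtain a b where a: "a \<noteq> 0" and b: "\<forall>y\<in>pspan J D. a \<bullet> y \<le> b"
      using separating_hyperplane_sets[OF convex_pspan convex_singleton, of J D x] x by auto
    obtain i where i: "i \<in> J" "0 < a \<bullet> D i" using pos a by auto
    have "0 \<le> b" using b \<open>0 \<in> pspan J D\<close> by fastforce
    \<comment> \<open>This multiple of \<open>D i\<close> makes the functional take the value \<open>b + 1\<close>.\<close>
    define t where "t = (b + 1) / (a \<bullet> D i)"
    have "t *\<^sub>R D i \<in> pspan J D"
      using assms i \<open>0 \<le> b\<close> by (intro scaleR_mem_pspan) (auto simp: t_def)
    then have "a \<bullet> (t *\<^sub>R D i) \<le> b" using b by blast
    then show False using i by (simp add: t_def)
  qed
qed

text \<open>
  A set \<open>J\<close> of the prescribed size meets \<open>P\<close> for pigeonhole reasons when \<open>card P \<ge> k\<close>; the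
  complement of \<open>P\<close> is the extremal choice when \<open>card P < k\<close>.
\<close>

lemma all_large_subsets_meet_iff:
  assumes "finite I" "P \<subseteq> I"
  shows "(\<forall>J. J \<subseteq> I \<and> card J + k \<ge> card I + 1 \<longrightarrow> J \<inter> P \<noteq> {}) \<longleftrightarrow> k \<le> card P"
proof
  assume meet: "\<forall>J. J \<subseteq> I \<and> card J + k \<ge> card I + 1 \<longrightarrow> J \<inter> P \<noteq> {}"
  have "\<not> card (I - P) + k \<ge> card I + 1"
    using meet[rule_format, of "I - P"] by auto
  moreover have "card (I - P) + card P = card I"
    using assms by (metis card_Diff_subset card_mono finite_subset le_add_diff_inverse2)
  ultimately show "k \<le> card P" by linarith
next
  assume k: "k \<le> card P"
  show "\<forall>J. J \<subseteq> I \<and> card J + k \<ge> card I + 1 \<longrightarrow> J \<inter> P \<noteq> {}"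
  proof (intro allI impI notI)
    fix J assume J: "J \<subseteq> I \<and> card J + k \<ge> card I + 1" and "J \<inter> P = {}"
    then have "card J + card P = card (J \<union> P)"
      using assms by (metis card_Un_disjoint finite_subset)
    also have "\<dots> \<le> card I" using J assms by (intro card_mono) auto
    finally show False using J k by linarith
  qed
qed

lemma positive_k_spanning_set_iff_card:
  fixes D :: "'i \<Rightarrow> 'a::euclidean_space"
  assumes "finite I"
  shows "positive_k_spanning_set k I D \<longleftrightarrow> (\<forall>u. u \<noteq> 0 \<longrightarrow> k \<le> card {i\<in>I. 0 < u \<bullet> D i})"
proof -
  have "positive_k_spanning_set k I D \<longleftrightarrow>
      (\<forall>J. J \<subseteq> I \<and> card J + k \<ge> card I + 1 \<longrightarrow> pspan J D = UNIV)"
    unfolding positive_k_spanning_set_def pspan_k_def by blast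
  also have "\<dots> \<longleftrightarrow> (\<forall>J. J \<subseteq> I \<and> card J + k \<ge> card I + 1 \<longrightarrow>
      (\<forall>u. u \<noteq> 0 \<longrightarrow> J \<inter> {i\<in>I. 0 < u \<bullet> D i} \<noteq> {}))"
  proof (intro all_cong1 imp_cong refl)
    fix J assume "J \<subseteq> I \<and> card J + k \<ge> card I + 1"
    then show "pspan J D = UNIV \<longleftrightarrow> (\<forall>u. u \<noteq> 0 \<longrightarrow> J \<inter> {i\<in>I. 0 < u \<bullet> D i} \<noteq> {})"
      using pspan_eq_UNIV_iff[of J D] finite_subset[OF _ assms] by blast
  qed
  also have "\<dots> \<longleftrightarrow> (\<forall>u. u \<noteq> 0 \<longrightarrow>
      (\<forall>J. J \<subseteq> I \<and> card J + k \<ge> card I + 1 \<longrightarrow> J \<inter> {i\<in>I. 0 < u \<bullet> D i} \<noteq> {}))"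
    by blast
  also have "\<dots> \<longleftrightarrow> (\<forall>u. u \<noteq> 0 \<longrightarrow> k \<le> card {i\<in>I. 0 < u \<bullet> D i})"
    using all_large_subsets_meet_iff[OF assms, of "{i\<in>I. 0 < _ \<bullet> D i}" k] by simp
  finally show ?thesis .
qed

lemma max_min_cosine_pos_iff_card:
  fixes D :: "'i \<Rightarrow> 'a::real_inner"
  assumes fin: "finite I" and nz: "\<And>i. i \<in> I \<Longrightarrow> D i \<noteq> 0" and k: "1 \<le> k" "k \<le> card I"
  shows "0 < max_min_cosine k I D u \<longleftrightarrow> k \<le> card {i\<in>I. 0 < u \<bullet> D i}"
proof -
  let ?F = "{J. J \<subseteq> I \<and> card J = k}" and ?P = "{i\<in>I. 0 < u \<bullet> D i}"
  have "finite ?F" using fin by auto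
  moreover have "?F \<noteq> {}"
    using k by (metis (mono_tags, lifting) empty_Collect_eq obtain_subset_with_card_n)
  ultimately have "0 < max_min_cosine k I D u \<longleftrightarrow>
      (\<exists>J\<in>?F. 0 < (MIN i\<in>J. (u \<bullet> D i) / norm (D i)))"
    unfolding max_min_cosine_def by (subst Max_gr_iff) auto
  also have "\<dots> \<longleftrightarrow> (\<exists>J\<in>?F. J \<subseteq> ?P)"
  proof (rule bex_cong[OF refl])
    fix J assume J: "J \<in> ?F"
    then have "finite J" "J \<noteq> {}" using fin k finite_subset by auto
    then have "0 < (MIN i\<in>J. (u \<bullet> D i) / norm (D i)) \<longleftrightarrow> (\<forall>i\<in>J. 0 < (u \<bullet> D i) / norm (D i))"
      by (subst Min_gr_iff) auto
    also have "\<dots> \<longleftrightarrow> J \<subseteq> ?P"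
      using J nz by (auto simp: zero_less_divide_iff)
    finally show "0 < (MIN i\<in>J. (u \<bullet> D i) / norm (D i)) \<longleftrightarrow> J \<subseteq> ?P" .
  qed
  also have "\<dots> \<longleftrightarrow> k \<le> card ?P"
  proof
    assume "\<exists>J\<in>?F. J \<subseteq> ?P"
    then show "k \<le> card ?P" using fin by (auto intro: card_mono)
  next
    assume "k \<le> card ?P"
    then obtain J where "J \<subseteq> ?P" "card J = k" by (metis obtain_subset_with_card_n)
    then show "\<exists>J\<in>?F. J \<subseteq> ?P" by blast
  qed
  finally show ?thesis .
qed

theorem theorem4p1:
  fixes D :: "'i \<Rightarrow> real ^ 'n" and I :: "'i set" and k :: nat
  assumes "CARD('n) \<ge> 2"
    and "finite I"
    and "\<And>i. i \<in> I \<Longrightarrow> D i \<noteq> 0"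
    and "1 \<le> k" and "k \<le> card I"
  shows "positive_k_spanning_set k I D \<longleftrightarrow> cosine_measure_k k I D > 0"
proof -
  let ?P = "\<lambda>u. {i\<in>I. 0 < u \<bullet> D i}"
  \<comment> \<open>\<open>P u\<close> depends only on the direction of \<open>u\<close>, so unit vectors suffice.\<close>
  have normalise: "?P (u /\<^sub>R norm u) = ?P u" if "u \<noteq> 0" for u
    using that by (auto simp: zero_less_mult_iff)
  have "positive_k_spanning_set k I D \<longleftrightarrow> (\<forall>u. u \<noteq> 0 \<longrightarrow> k \<le> card (?P u))"
    by (rule positive_k_spanning_set_iff_card[OF assms(2)])
  also have "\<dots> \<longleftrightarrow> (\<forall>u. norm u = 1 \<longrightarrow> k \<le> card (?P u))"
  proof
    assume unit: "\<forall>u. norm u = 1 \<longrightarrow> k \<le> card (?P u)"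
    show "\<forall>u. u \<noteq> 0 \<longrightarrow> k \<le> card (?P u)"
    proof (intro allI impI)
      fix u :: "real ^ 'n"
      assume u: "u \<noteq> 0"
      then have "norm (u /\<^sub>R norm u) = 1" by simp
      then have "k \<le> card (?P (u /\<^sub>R norm u))" using unit by blast
      then show "k \<le> card (?P u)" unfolding normalise[OF u] .
    qed
  qed (metis norm_zero zero_neq_one)
  also have "\<dots> \<longleftrightarrow> (\<forall>u. norm u = 1 \<longrightarrow> 0 < max_min_cosine k I D u)"
    using max_min_cosine_pos_iff_card[OF assms(2-5)] by simp
  also have "\<dots> \<longleftrightarrow> 0 < cosine_measure_k k I D"
    using cosine_measure_k_attained[OF assms(2,4,5), of D] by (metis less_le_trans)
  finally show ?thesis .
qed

end
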